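(* Let $n\geq 1$ and let $a\in\mathcal T_n$ have rank $r=\operatorname{rank}(a)\geq n-6$. Then $\mu(\mathcal T_n^a)=2n-r$.
   Context: $\mathcal T_n$ is the full transformation semigroup on $\{1,\dots,n\}$ (all self-maps, under composition). The rank of $a\in\mathcal T_n$ is the size of its image. The variant $\mathcal T_n^a$ is the semigroup with underlying set $\mathcal T_n$ and operation $f\star g=fag$. For a finite semigroup $S$, $\mu(S)$ is the least $m\geq1$ such that $S$ embeds in $\mathcal T_m$. *)

theory Defs
  imports Main "HOL-Library.FuncSet"
begin

text \<open>
  Semigroups are given by a carrier set and an operation on it. Self-maps of \<open>{1..n}\<close>
  are extensional functions, so that each of them is represented exactly once.
\<close>

definition full_trans :: "nat \<Rightarrow> (nat \<Rightarrow> nat) set" where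
  "full_trans n = {1..n} \<rightarrow>\<^sub>E {1..n}"

text \<open>
  Maps are composed from left to right (first \<open>f\<close>, then \<open>g\<close>). The opposite convention
  replaces every full transformation semigroup and every variant by its opposite
  semigroup, hence gives the same values of \<open>min_trans_degree\<close> below.
\<close>

definition trans_mult :: "nat \<Rightarrow> (nat \<Rightarrow> nat) \<Rightarrow> (nat \<Rightarrow> nat) \<Rightarrow> (nat \<Rightarrow> nat)" where
  "trans_mult n f g = compose {1..n} g f"

definition trans_rank :: "nat \<Rightarrow> (nat \<Rightarrow> nat) \<Rightarrow> nat" where
  "trans_rank n a = card (a ` {1..n})"

definition variant_mult ::
    "nat \<Rightarrow> (nat \<Rightarrow> nat) \<Rightarrow> (nat \<Rightarrow> nat) \<Rightarrow> (nat \<Rightarrow> nat) \<Rightarrow> (nat \<Rightarrow> nat)" where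
  "variant_mult n a f g = trans_mult n (trans_mult n f a) g"

definition semigroup_embedding ::
    "('a \<Rightarrow> 'b) \<Rightarrow> 'a set \<Rightarrow> ('a \<Rightarrow> 'a \<Rightarrow> 'a) \<Rightarrow> 'b set \<Rightarrow> ('b \<Rightarrow> 'b \<Rightarrow> 'b) \<Rightarrow> bool" where
  "semigroup_embedding \<phi> S mS T mT \<longleftrightarrow>
     \<phi> \<in> S \<rightarrow> T \<and> inj_on \<phi> S \<and> (\<forall>x\<in>S. \<forall>y\<in>S. \<phi> (mS x y) = mT (\<phi> x) (\<phi> y))"

definition embeds_in_trans :: "'a set \<Rightarrow> ('a \<Rightarrow> 'a \<Rightarrow> 'a) \<Rightarrow> nat \<Rightarrow> bool" where
  "embeds_in_trans S mS m \<longleftrightarrow>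
     (\<exists>\<phi>. semigroup_embedding \<phi> S mS (full_trans m) (trans_mult m))"

text \<open>The set of such \<open>m\<close> is nonempty for a finite semigroup, by Cayley's theorem.\<close>

definition min_trans_degree :: "'a set \<Rightarrow> ('a \<Rightarrow> 'a \<Rightarrow> 'a) \<Rightarrow> nat" where
  "min_trans_degree S mS = (LEAST m. 1 \<le> m \<and> embeds_in_trans S mS m)"

lemma trans_mult_closed:
  "f \<in> full_trans n \<Longrightarrow> g \<in> full_trans n \<Longrightarrow> trans_mult n f g \<in> full_trans n"
  by (auto simp: full_trans_def trans_mult_def compose_def PiE_iff)

lemma trans_mult_assoc:
  "f \<in> full_trans n \<Longrightarrow>
    trans_mult n (trans_mult n f g) h = trans_mult n f (trans_mult n g h)"
  unfolding trans_mult_def full_trans_def by (rule compose_assoc) auto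

lemma variant_mult_closed:
  "a \<in> full_trans n \<Longrightarrow> f \<in> full_trans n \<Longrightarrow> g \<in> full_trans n \<Longrightarrow>
    variant_mult n a f g \<in> full_trans n"
  by (simp add: variant_mult_def trans_mult_closed)

lemma variant_mult_assoc:
  "a \<in> full_trans n \<Longrightarrow> f \<in> full_trans n \<Longrightarrow> g \<in> full_trans n \<Longrightarrow>
    variant_mult n a (variant_mult n a f g) h = variant_mult n a f (variant_mult n a g h)"
  by (simp add: variant_mult_def trans_mult_closed trans_mult_assoc)

end

theory Submission
  imports Defs
begin

text \<open>
  Upper bound: adjoin to \<open>{1..n}\<close> a copy of the complement of the image of \<open>a\<close>, and let \<open>f\<close>
  act by \<open>p \<mapsto> f (a p)\<close> on \<open>{1..n}\<close> and by \<open>q \<mapsto> f q\<close> on the adjoined points.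

  Lower bound: let \<open>\<phi>\<close> embed the variant in the transformations of \<open>m\<close> points, and let \<open>c\<close> be the
  number of points that lie in the image of some \<open>\<phi> h\<close>. If \<open>f\<close> and \<open>g\<close> agree on the image of
  \<open>a\<close>, then \<open>\<phi> f\<close> and \<open>\<phi> g\<close> agree on these \<open>c\<close> points, so \<open>n ^ (n - r) \<le> c ^ (m - c)\<close>. This
  gives \<open>m \<ge> 2 * n - r\<close> once \<open>c\<close> is not much smaller than \<open>n\<close>. To bound \<open>c\<close> from below, send \<open>i\<close>
  to the image of a point \<open>p\<close> under the representative of the constant map with value \<open>i\<close>. For
  varying \<open>p\<close> these maps jointly separate \<open>{1..n}\<close>, distinct ones have disjoint images, and each
  nonconstant one has its kernel inside that of \<open>a\<close>. If one of them is injective then \<open>c \<ge> n\<close>.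
  Otherwise there are at least two nonconstant ones, and on a kernel class of \<open>a\<close> with \<open>s\<close> elements
  their image sizes add up to at least \<open>2 + log 2 s\<close>. For defect at most 6 this leaves only
  \<open>c \<ge> n - 1\<close>, or \<open>n = 7\<close>, \<open>r = 1\<close> and \<open>c = 5\<close>.
\<close>

lemma trans_mult_apply:
  "x \<in> {1..n} \<Longrightarrow> trans_mult n f g x = g (f x)"
  by (simp add: trans_mult_def compose_def)

lemma full_trans_apply: "f \<in> full_trans n \<Longrightarrow> x \<in> {1..n} \<Longrightarrow> f x \<in> {1..n}"
  unfolding full_trans_def by (rule PiE_mem)

lemma variant_mult_apply:
  "x \<in> {1..n} \<Longrightarrow> variant_mult n a f g x = g (a (f x))"
  by (simp add: variant_mult_def trans_mult_apply)

lemma full_trans_eqI: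
  assumes "f \<in> full_trans n" "g \<in> full_trans n" "\<And>x. x \<in> {1..n} \<Longrightarrow> f x = g x"
  shows "f = g"
  using assms unfolding full_trans_def by (rule PiE_ext)

lemma restrict_full_trans:
  "(\<And>x. x \<in> {1..n} \<Longrightarrow> f x \<in> {1..n}) \<Longrightarrow> restrict f {1..n} \<in> full_trans n"
  by (auto simp: full_trans_def)

lemma trans_rank_le: "trans_rank n a \<le> n"
  using card_image_le[of "{1..n}" a] by (simp add: trans_rank_def)

section \<open>Upper bound: an embedding in degree \<open>2 * n - trans_rank n a\<close>\<close>

lemma variant_embeds:
  assumes a: "a \<in> full_trans n"
  shows "embeds_in_trans (full_trans n) (variant_mult n a) (2 * n - trans_rank n a)"
proof -
  define m where "m = 2 * n - trans_rank n a"
  define B where "B = {1..n} - a ` {1..n}"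
  have sub: "a ` {1..n} \<subseteq> {1..n}"
    using full_trans_apply[OF a] by blast
  have "card {n+1..m} = card B"
    using trans_rank_le[of n a] sub
    by (simp add: B_def m_def card_Diff_subset trans_rank_def)
  then obtain \<beta> where \<beta>: "bij_betw \<beta> {n+1..m} B"
    using finite_same_card_bij[of "{n+1..m}" B] by (auto simp: B_def)
  \<comment> \<open>Agreement with \<open>a\<close> on \<open>{1..n}\<close> will make
    \<open>\<phi>\<close> multiplicative; the values \<open>\<beta> p\<close> make
    \<open>\<delta>\<close> surjective onto \<open>{1..n}\<close>, hence \<open>\<phi>\<close>
    injective.\<close>
  define \<delta> where "\<delta> p = (if p \<le> n then a p else \<beta> p)" for p
  have nm: "n \<le> m"
    using trans_rank_le[of n a] by (simp add: m_def)
  have \<delta>_in: "\<delta> p \<in> {1..n}" if "p \<in> {1..m}" for p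
  proof (cases "p \<le> n")
    case True
    then show ?thesis using that full_trans_apply[OF a, of p] by (simp add: \<delta>_def)
  next
    case False
    then have "\<beta> p \<in> B" using that \<beta> by (auto simp: bij_betw_def)
    then show ?thesis using False by (simp add: \<delta>_def B_def)
  qed
  have \<delta>_surj: "\<exists>p\<in>{1..m}. \<delta> p = x" if x: "x \<in> {1..n}" for x
  proof (cases "x \<in> a ` {1..n}")
    case True
    then obtain p where "p \<in> {1..n}" "a p = x" by blast
    then show ?thesis using nm by (intro bexI[of _ p]) (auto simp: \<delta>_def)
  next
    case False
    then have "x \<in> \<beta> ` {n+1..m}" using x \<beta> by (auto simp: bij_betw_def B_def)
    then obtain p where "p \<in> {n+1..m}" "\<beta> p = x" by blast
    then show ?thesis by (intro bexI[of _ p]) (auto simp: \<delta>_def)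
  qed
  define \<phi> where "\<phi> f = (\<lambda>p\<in>{1..m}. f (\<delta> p))" for f :: "nat \<Rightarrow> nat"
  have \<phi>_in: "\<phi> f \<in> full_trans m" if "f \<in> full_trans n" for f
    unfolding \<phi>_def
  proof (rule restrict_full_trans)
    fix p assume "p \<in> {1..m}"
    then show "f (\<delta> p) \<in> {1..m}"
      using full_trans_apply[OF that \<delta>_in] nm by fastforce
  qed
  have "semigroup_embedding \<phi> (full_trans n) (variant_mult n a) (full_trans m) (trans_mult m)"
    unfolding semigroup_embedding_def
  proof (intro conjI ballI)
    show "\<phi> \<in> full_trans n \<rightarrow> full_trans m" using \<phi>_in by blast
    show "inj_on \<phi> (full_trans n)"
    proof (rule inj_onI)
      fix f g assume fg: "f \<in> full_trans n" "g \<in> full_trans n" "\<phi> f = \<phi> g"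
      show "f = g"
      proof (rule full_trans_eqI[OF fg(1,2)])
        fix x assume "x \<in> {1..n}"
        then obtain p where "p \<in> {1..m}" "\<delta> p = x" using \<delta>_surj by blast
        then show "f x = g x" using fun_cong[OF fg(3), of p] by (simp add: \<phi>_def)
      qed
    qed
    fix f g assume f: "f \<in> full_trans n" and g: "g \<in> full_trans n"
    show "\<phi> (variant_mult n a f g) = trans_mult m (\<phi> f) (\<phi> g)"
    proof (rule full_trans_eqI)
      show "\<phi> (variant_mult n a f g) \<in> full_trans m"
        by (intro \<phi>_in variant_mult_closed a f g)
      show "trans_mult m (\<phi> f) (\<phi> g) \<in> full_trans m"
        by (intro trans_mult_closed \<phi>_in f g)
      fix p assume p: "p \<in> {1..m}"
      have "f (\<delta> p) \<in> {1..n}" using full_trans_apply[OF f \<delta>_in[OF p]] .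
      then have "\<delta> (f (\<delta> p)) = a (f (\<delta> p))" "f (\<delta> p) \<in> {1..m}"
        using nm by (auto simp: \<delta>_def)
      then show "\<phi> (variant_mult n a f g) p = trans_mult m (\<phi> f) (\<phi> g) p"
        using p by (simp add: trans_mult_apply \<phi>_def variant_mult_apply[OF \<delta>_in[OF p]])
    qed
  qed
  then show ?thesis unfolding embeds_in_trans_def m_def by blast
qed

section \<open>Image sizes of separating families\<close>

text \<open>Separation embeds \<open>K\<close> in the product of the images. A factor of size k is
  at most 2^(k-1), and with at least two factors the exponents k-1 add up to at most the sum of the
  sizes minus 2, whence the 4.\<close>

lemma card_separated_le:
  fixes P :: "('a \<Rightarrow> 'b) set"
  assumes "finite K" "K \<noteq> {}" "finite P" "2 \<le> card P"
    and sep: "\<And>x y. x \<in> K \<Longrightarrow> y \<in> K \<Longrightarrow> x \<noteq> y \<Longrightarrow> \<exists>\<pi>\<in>P. \<pi> x \<noteq> \<pi> y"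
  shows "4 * card K \<le> 2 ^ (\<Sum>\<pi>\<in>P. card (\<pi> ` K))"
proof -
  have pos: "1 \<le> card (\<pi> ` K)" for \<pi> :: "'a \<Rightarrow> 'b"
    using assms(1,2) by (simp add: Suc_le_eq card_gt_0_iff)
  have "card K \<le> card (\<Pi>\<^sub>E \<pi>\<in>P. \<pi> ` K)"
  proof (rule card_inj_on_le)
    show "inj_on (\<lambda>x. \<lambda>\<pi>\<in>P. \<pi> x) K"
      by (rule inj_onI) (metis restrict_apply' sep)
    show "finite (\<Pi>\<^sub>E \<pi>\<in>P. \<pi> ` K)"
      using assms(1,3) by (intro finite_PiE) auto
  qed auto
  also have "\<dots> = (\<Prod>\<pi>\<in>P. card (\<pi> ` K))"
    using assms(3) by (rule card_PiE)
  also have "\<dots> \<le> (\<Prod>\<pi>\<in>P. 2 ^ (card (\<pi> ` K) - 1))"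
  proof (rule prod_mono)
    fix \<pi> assume "\<pi> \<in> P"
    have "card (\<pi> ` K) - 1 < 2 ^ (card (\<pi> ` K) - 1)" by (rule less_exp)
    then show "0 \<le> card (\<pi> ` K) \<and> card (\<pi> ` K) \<le> 2 ^ (card (\<pi> ` K) - 1)" by linarith
  qed
  also have "\<dots> = 2 ^ (\<Sum>\<pi>\<in>P. card (\<pi> ` K) - 1)" by (simp add: power_sum)
  finally have "4 * card K \<le> 2 ^ (2 + (\<Sum>\<pi>\<in>P. card (\<pi> ` K) - 1))"
    by (simp add: power_add)
  also have "\<dots> \<le> 2 ^ (\<Sum>\<pi>\<in>P. card (\<pi> ` K))"
  proof (rule power_increasing)
    have "(\<Sum>\<pi>\<in>P. card (\<pi> ` K)) = (\<Sum>\<pi>\<in>P. (card (\<pi> ` K) - 1) + 1)"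
      by (intro sum.cong refl) (metis le_add_diff_inverse2 pos)
    also have "\<dots> = (\<Sum>\<pi>\<in>P. card (\<pi> ` K) - 1) + card P"
      by (subst sum.distrib) simp
    finally show "2 + (\<Sum>\<pi>\<in>P. card (\<pi> ` K) - 1) \<le> (\<Sum>\<pi>\<in>P. card (\<pi> ` K))"
      using assms(4) by simp
  qed simp
  finally show ?thesis .
qed

text \<open>For s = 1, ..., 6 the least possible \<sigma> is 2, 3, 4, 4, 5, 5, so \<sigma> can fall
  below s only from s = 6 on.\<close>

lemma exponent_bounds:
  fixes s \<sigma> :: nat
  assumes "1 \<le> s" "4 * s \<le> 2 ^ \<sigma>"
  shows "s \<le> 3 \<Longrightarrow> s + 1 \<le> \<sigma>" "s \<le> 5 \<Longrightarrow> s \<le> \<sigma>" "5 \<le> s \<Longrightarrow> 5 \<le> \<sigma>"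
proof -
  have *: "k < \<sigma>" if "2 ^ k < 4 * s" for k
    using assms(2) that power_less_imp_less_exp[of "2::nat" k \<sigma>] by linarith
  show "s + 1 \<le> \<sigma>" if "s \<le> 3"
  proof -
    have "s = 1 \<or> s = 2 \<or> s = 3" using that assms(1) by linarith
    then show ?thesis using *[of 1] *[of 2] *[of 3] by auto
  qed
  show "s \<le> \<sigma>" if "s \<le> 5"
  proof -
    have "s = 1 \<or> s = 2 \<or> s = 3 \<or> s = 4 \<or> s = 5" using that assms(1) by linarith
    then show ?thesis using *[of 1] *[of 2] *[of 3] *[of 4] by auto
  qed
  show "5 \<le> \<sigma>" if "5 \<le> s" using *[of 4] that by simp
qed

text \<open>By \<open>ker\<close>, each member of \<open>P\<close> has disjoint images on distinct
  fibres of \<open>a\<close>, so the count can be made fibre by fibre. Only a fibre with at least 6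
  elements can lose points, and the defect bound admits at most one, of size 6 or 7.\<close>

lemma sum_card_images_ge:
  fixes a :: "'a \<Rightarrow> 'b" and P :: "('a \<Rightarrow> 'c) set"
  assumes X: "finite X" and P: "finite P" "2 \<le> card P"
    and sep: "\<And>x y. x \<in> X \<Longrightarrow> y \<in> X \<Longrightarrow> x \<noteq> y \<Longrightarrow> \<exists>\<pi>\<in>P. \<pi> x \<noteq> \<pi> y"
    and ker: "\<And>\<pi> x y. \<pi> \<in> P \<Longrightarrow> x \<in> X \<Longrightarrow> y \<in> X \<Longrightarrow> \<pi> x = \<pi> y \<Longrightarrow> a x = a y"
    and defect: "card X \<le> card (a ` X) + 6"
    and C: "(\<Sum>\<pi>\<in>P. card (\<pi> ` X)) \<le> C"
  shows "card X \<le> C \<or> (card X \<le> C + 1 \<and> card (a ` X) < card X)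
    \<or> (card X = 7 \<and> card (a ` X) = 1 \<and> 5 \<le> C)"
proof -
  define A where "A = a ` X"
  define K where "K y = {x \<in> X. a x = y}" for y
  define s where "s y = card (K y)" for y
  define \<sigma> where "\<sigma> y = (\<Sum>\<pi>\<in>P. card (\<pi> ` K y))" for y
  have finA: "finite A" using X by (simp add: A_def)
  have finK: "finite (K y)" for y using X by (simp add: K_def)
  have Kne: "K y \<noteq> {}" if "y \<in> A" for y using that by (auto simp: K_def A_def)
  have spos: "1 \<le> s y" if "y \<in> A" for y
    using Kne[OF that] finK[of y] by (simp add: s_def Suc_le_eq card_gt_0_iff)
  have pow: "4 * s y \<le> 2 ^ \<sigma> y" if "y \<in> A" for y
    unfolding s_def \<sigma>_def
    by (rule card_separated_le[OF finK Kne[OF that] P]) (auto simp: K_def intro: sep)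
  note bounds = exponent_bounds[OF spos pow]
  have "card (\<Union>y\<in>A. K y) = (\<Sum>y\<in>A. card (K y))"
    using finA finK by (intro card_UN_disjoint) (auto simp: K_def)
  moreover have UK: "(\<Union>y\<in>A. K y) = X" by (auto simp: K_def A_def)
  ultimately have cardX: "card X = (\<Sum>y\<in>A. s y)" by (simp add: s_def)
  have "card (\<pi> ` X) = (\<Sum>y\<in>A. card (\<pi> ` K y))" if "\<pi> \<in> P" for \<pi>
  proof -
    have "card (\<Union>y\<in>A. \<pi> ` K y) = (\<Sum>y\<in>A. card (\<pi> ` K y))"
      using finA finK ker[OF that]
      by (intro card_UN_disjoint) (auto simp: K_def)
    then show ?thesis using UK by (simp add: image_UN[symmetric])
  qed
  then have "(\<Sum>\<pi>\<in>P. card (\<pi> ` X)) = (\<Sum>\<pi>\<in>P. \<Sum>y\<in>A. card (\<pi> ` K y))" by simp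
  also have "\<dots> = (\<Sum>y\<in>A. \<sigma> y)" unfolding \<sigma>_def by (rule sum.swap)
  finally have C': "(\<Sum>y\<in>A. \<sigma> y) \<le> C" using C by simp
  show ?thesis
  proof (cases "\<exists>z\<in>A. 6 \<le> s z")
    case False
    then have "(\<Sum>y\<in>A. s y) \<le> (\<Sum>y\<in>A. \<sigma> y)"
      using bounds(2) by (intro sum_mono) fastforce
    then show ?thesis using C' cardX by linarith
  next
    case True
    then obtain z where z: "z \<in> A" "6 \<le> s z" by blast
    define R where "R = A - {z}"
    have split: "(\<Sum>y\<in>A. f y) = f z + (\<Sum>y\<in>R. f y)" for f :: "'b \<Rightarrow> nat"
      unfolding R_def using finA z(1) by (rule sum.remove)
    have cardA: "card A = 1 + card R"
      unfolding R_def using card_Suc_Diff1[OF finA z(1)] by simp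
    \<comment> \<open>The excesses \<open>s y - 1\<close> over all fibres sum to at most 6, and
      \<open>z\<close> already takes at least 5.\<close>
    have small: "s y \<le> 2" if y: "y \<in> R" for y
    proof -
      have "finite R" using finA by (simp add: R_def)
      then have R: "(\<Sum>x\<in>R. s x) = s y + (\<Sum>x\<in>R - {y}. s x)" "card R = 1 + card (R - {y})"
        using y card_Suc_Diff1[of R y] sum.remove[of R y s] by simp_all
      have "(\<Sum>x\<in>R - {y}. 1) \<le> (\<Sum>x\<in>R - {y}. s x)"
        using spos by (intro sum_mono) (auto simp: R_def)
      then show ?thesis
        using defect cardX split[of s] R cardA z(2) by (simp add: A_def[symmetric])
    qed
    have "(\<Sum>y\<in>R. s y + 1) \<le> (\<Sum>y\<in>R. \<sigma> y)"
    proof (rule sum_mono)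
      fix y assume "y \<in> R"
      then show "s y + 1 \<le> \<sigma> y" using bounds(1)[of y] small[of y] by (simp add: R_def)
    qed
    then have "(\<Sum>y\<in>R. s y) + card R \<le> (\<Sum>y\<in>R. \<sigma> y)"
      by (subst (asm) sum.distrib) simp
    moreover have "5 \<le> \<sigma> z" using bounds(3)[OF z(1) z(1)] z(2) by simp
    moreover have "(\<Sum>y\<in>R. 1) \<le> (\<Sum>y\<in>R. s y)"
      using spos by (intro sum_mono) (auto simp: R_def)
    moreover have "R = {} \<Longrightarrow> (\<Sum>y\<in>R. s y) = 0" by simp
    moreover have "card R = 0 \<Longrightarrow> R = {}" using finA by (simp add: R_def)
    \<comment> \<open>The fibre over \<open>z\<close> loses at most 7 - 5 = 2, and every other fibre
      regains at least 1. A loss of 2 thus forces \<open>R = {}\<close> and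
      \<open>s z = 7\<close>.\<close>
    ultimately show ?thesis
      using C' cardX split[of s] split[of \<sigma>] cardA defect z(2)
      unfolding A_def[symmetric] by (cases "card R = 0") auto
  qed
qed

section \<open>Power inequalities\<close>

lemma Suc_power_le:
  fixes x w :: nat
  assumes "w < x"
  shows "Suc x ^ w \<le> x ^ Suc w"
proof -
  have "Suc x ^ w * (x - w) \<le> x ^ Suc w" if "w \<le> x" for w
    using that
  proof (induction w)
    case 0
    show ?case by simp
  next
    case (Suc w)
    then obtain k where "x = Suc w + k" using le_Suc_ex by blast
    then have k: "x = Suc (w + k)" by simp
    have "Suc x * k \<le> x * (x - w)" by (simp add: k algebra_simps)
    then have "Suc x ^ w * (Suc x * k) \<le> Suc x ^ w * (x * (x - w))" by (rule mult_le_mono2)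
    also have "\<dots> = x * (Suc x ^ w * (x - w))" by simp
    also have "\<dots> \<le> x * x ^ Suc w" using Suc k by (intro mult_le_mono2) simp
    finally show ?case by (simp add: k algebra_simps)
  qed
  from this[of w] have "Suc x ^ w * 1 \<le> Suc x ^ w * (x - w)" "Suc x ^ w * (x - w) \<le> x ^ Suc w"
    using assms by (simp_all del: power_Suc)
  then show ?thesis by linarith
qed

text \<open>Each use of \<open>Suc_power_le\<close> trades one unit of the base for one unit of the
  exponent.\<close>

lemma add_power_le:
  fixes n w j :: nat
  assumes "w + j \<le> n"
  shows "(n + j) ^ w \<le> n ^ (w + j)"
  using assms
proof (induction j arbitrary: w)
  case (Suc j)
  have "(n + Suc j) ^ w \<le> (n + j) ^ Suc w"
    using Suc_power_le[of w "n + j"] Suc.prems by simp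
  also have "\<dots> \<le> n ^ (Suc w + j)" using Suc by (intro Suc.IH) simp
  finally show ?case by simp
qed simp

text \<open>To be used with \<open>d\<close> the defect of \<open>a\<close>,
  \<open>c = card imgs\<close> and \<open>w = m - c\<close>.\<close>

lemma degree_arith:
  fixes n d c w :: nat
  assumes n: "2 \<le> n" "d < n" and le: "n ^ d \<le> c ^ w"
    and c: "n \<le> c \<or> (n \<le> c + 1 \<and> 0 < d) \<or> (n = 7 \<and> d = 6 \<and> 5 \<le> c)"
  shows "n + d \<le> c + w"
proof (rule ccontr)
  assume neg: "\<not> n + d \<le> c + w"
  show False
  proof (cases "n \<le> c")
    case True
    then obtain j where j: "c = n + j" using le_Suc_ex by blast
    have wj: "w + j < d" using neg j by simp
    note le
    also have "c ^ w \<le> n ^ (w + j)" unfolding j using wj n by (intro add_power_le) simp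
    finally have "n ^ d \<le> n ^ (w + j)" .
    then have "d \<le> w + j" using n(1) power_le_imp_le_exp[of n d "w + j"] by simp
    then show False using wj by simp
  next
    case False
    then have d: "0 < d" and cn: "c < n" using c by auto
    have "n = c + 1 \<or> (n = 7 \<and> d = 6 \<and> c = 5)" using c cn by linarith
    then show False
    proof
      assume "n = c + 1"
      then have "w \<le> d" "0 < c" using neg n by auto
      then have "c ^ w \<le> c ^ d" by (intro power_increasing) auto
      also have "\<dots> < n ^ d" using cn d by (intro power_strict_mono) auto
      finally show False using le by simp
    next
      assume *: "n = 7 \<and> d = 6 \<and> c = 5"
      \<comment> \<open>Here \<open>w \<le> 7\<close>, and 5^7 = 78125 is less than 7^6 =
        117649.\<close>
      then have "c ^ w \<le> 5 ^ 7" using neg power_increasing[of w 7 "5::nat"] by simp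
      then show False using le * by simp
    qed
  qed
qed

section \<open>Points hit by an arbitrary embedding\<close>

locale variant_embedding =
  fixes n m :: nat and a :: "nat \<Rightarrow> nat" and \<phi> :: "(nat \<Rightarrow> nat) \<Rightarrow> nat \<Rightarrow> nat"
  assumes n2: "2 \<le> n"
    and a: "a \<in> full_trans n"
    and emb: "semigroup_embedding \<phi> (full_trans n) (variant_mult n a) (full_trans m) (trans_mult m)"
begin

definition imgs :: "nat set" where
  "imgs = (\<Union>h\<in>full_trans n. \<phi> h ` {1..m})"

definition cst :: "nat \<Rightarrow> nat \<Rightarrow> nat" where
  "cst i = (\<lambda>x\<in>{1..n}. i)"

lemma cst_in: "i \<in> {1..n} \<Longrightarrow> cst i \<in> full_trans n"
  unfolding cst_def by (rule restrict_full_trans)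

lemma a_in: "x \<in> {1..n} \<Longrightarrow> a x \<in> {1..n}"
  using full_trans_apply[OF a] .

lemma \<phi>_in: "f \<in> full_trans n \<Longrightarrow> \<phi> f \<in> full_trans m"
  using emb by (auto simp: semigroup_embedding_def)

lemma \<phi>_apply_in: "f \<in> full_trans n \<Longrightarrow> p \<in> {1..m} \<Longrightarrow> \<phi> f p \<in> {1..m}"
  using \<phi>_in full_trans_apply by blast

lemma \<phi>_mult:
  "f \<in> full_trans n \<Longrightarrow> g \<in> full_trans n \<Longrightarrow> p \<in> {1..m} \<Longrightarrow>
    \<phi> g (\<phi> f p) = \<phi> (variant_mult n a f g) p"
  using emb by (simp add: semigroup_embedding_def trans_mult_apply)

lemma \<phi>_eqD:
  assumes "f \<in> full_trans n" "g \<in> full_trans n" "\<And>p. p \<in> {1..m} \<Longrightarrow> \<phi> f p = \<phi> g p"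
  shows "f = g"
proof -
  have "\<phi> f = \<phi> g" using assms by (intro full_trans_eqI[of _ m] \<phi>_in)
  then show ?thesis using emb assms(1,2) by (auto simp: semigroup_embedding_def inj_on_def)
qed

lemma imgsI: "h \<in> full_trans n \<Longrightarrow> p \<in> {1..m} \<Longrightarrow> \<phi> h p \<in> imgs"
  unfolding imgs_def by blast

lemma imgs_sub: "imgs \<subseteq> {1..m}"
  using \<phi>_apply_in by (auto simp: imgs_def)

lemma finite_imgs: "finite imgs"
  using imgs_sub finite_subset by blast

lemma power_defect_le: "n ^ (n - trans_rank n a) \<le> card imgs ^ (m - card imgs)"
proof -
  define A where "A = a ` {1..n}"
  define B where "B = {1..n} - A"
  define W where "W = {1..m} - imgs"
  \<comment> \<open>The value 1 on the image of \<open>a\<close> is an arbitrary choice: it yields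
    \<open>n ^ card B\<close> maps that agree there, which \<open>\<phi>\<close> can then tell apart
    only on \<open>W\<close>.\<close>
  define ext where "ext g = (\<lambda>x\<in>{1..n}. if x \<in> A then 1 else g x)" for g :: "nat \<Rightarrow> nat"
  have A: "A \<subseteq> {1..n}" using a_in by (auto simp: A_def)
  have ext_in: "ext g \<in> full_trans n" if "g \<in> B \<rightarrow>\<^sub>E {1..n}" for g
    unfolding ext_def
  proof (rule restrict_full_trans)
    fix x assume "x \<in> {1..n}"
    then show "(if x \<in> A then 1 else g x) \<in> {1..n}"
      using PiE_mem[OF that, of x] by (auto simp: B_def)
  qed
  have "card (B \<rightarrow>\<^sub>E {1..n}) \<le> card (W \<rightarrow>\<^sub>E imgs)"
  proof (rule card_inj_on_le)
    show "finite (W \<rightarrow>\<^sub>E imgs)" using finite_imgs by (intro finite_PiE) (auto simp: W_def)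
    show "(\<lambda>g. restrict (\<phi> (ext g)) W) ` (B \<rightarrow>\<^sub>E {1..n}) \<subseteq> W \<rightarrow>\<^sub>E imgs"
      using imgsI[OF ext_in]
      by (intro image_subsetI restrict_PiE_iff[THEN iffD2] ballI) (simp add: W_def)
    show "inj_on (\<lambda>g. restrict (\<phi> (ext g)) W) (B \<rightarrow>\<^sub>E {1..n})"
    proof (rule inj_onI)
      fix g g' assume g: "g \<in> B \<rightarrow>\<^sub>E {1..n}" and g': "g' \<in> B \<rightarrow>\<^sub>E {1..n}"
        and eq: "restrict (\<phi> (ext g)) W = restrict (\<phi> (ext g')) W"
      have ext_eq: "ext g = ext g'"
      proof (rule \<phi>_eqD[OF ext_in[OF g] ext_in[OF g']])
        fix p assume p: "p \<in> {1..m}"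
        show "\<phi> (ext g) p = \<phi> (ext g') p"
        proof (cases "p \<in> imgs")
          case True
          then obtain h q where h: "h \<in> full_trans n" "q \<in> {1..m}" "p = \<phi> h q"
            by (auto simp: imgs_def)
          \<comment> \<open>In the product, \<open>a\<close> is applied just before the right
            factor, which is therefore seen only on the image of \<open>a\<close>.\<close>
          have "variant_mult n a h (ext g) = variant_mult n a h (ext g')"
          proof (rule full_trans_eqI)
            fix x assume x: "x \<in> {1..n}"
            then have "a (h x) \<in> A" using full_trans_apply[OF h(1)] by (auto simp: A_def)
            then show "variant_mult n a h (ext g) x = variant_mult n a h (ext g') x"
              using x A by (auto simp: variant_mult_apply ext_def)
          qed (intro variant_mult_closed a h ext_in g g')+
          then show ?thesis
            using \<phi>_mult[OF h(1) ext_in[OF g] h(2)] \<phi>_mult[OF h(1) ext_in[OF g'] h(2)] h(3) by simp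
        next
          case False
          then show ?thesis using p fun_cong[OF eq, of p] by (simp add: W_def)
        qed
      qed
      have "g x = g' x" if "x \<in> B" for x
        using that fun_cong[OF ext_eq, of x] by (simp add: ext_def B_def)
      then show "g = g'" using g g' by (rule PiE_ext[rotated 2])
    qed
  qed
  moreover have "card B = n - trans_rank n a"
    using A by (simp add: B_def trans_rank_def A_def card_Diff_subset)
  moreover have "card W = m - card imgs"
    using imgs_sub finite_imgs by (simp add: W_def card_Diff_subset)
  ultimately show ?thesis by (simp add: card_PiE B_def W_def)
qed

section \<open>Images of points under the constant maps\<close>

definition orb :: "nat \<Rightarrow> nat \<Rightarrow> nat" where
  "orb p = (\<lambda>i\<in>{1..n}. \<phi> (cst i) p)"

text \<open>The product of \<open>cst i\<close> and \<open>g\<close> is again constant, with value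
  \<open>g (a i)\<close>.\<close>

lemma \<phi>_orb:
  assumes "p \<in> {1..m}" "i \<in> {1..n}" "g \<in> full_trans n"
  shows "\<phi> g (orb p i) = orb p (g (a i))"
proof -
  have gi: "g (a i) \<in> {1..n}" using assms a_in full_trans_apply by blast
  have "variant_mult n a (cst i) g = cst (g (a i))"
    using assms gi a
    by (intro full_trans_eqI[of _ n] variant_mult_closed cst_in)
      (auto simp: variant_mult_apply cst_def)
  then show ?thesis using assms gi by (simp add: orb_def \<phi>_mult cst_in)
qed

text \<open>Constant maps are right zeros, so \<open>orb p\<close> is recovered from any point of its image.\<close>

lemma orb_eqI:
  assumes "p \<in> {1..m}" "q \<in> {1..m}" "i \<in> {1..n}" "j \<in> {1..n}" "orb p i = orb q j"
  shows "orb p = orb q"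
proof
  fix k
  show "orb p k = orb q k"
  proof (cases "k \<in> {1..n}")
    case True
    have "orb p k = \<phi> (cst k) (orb p i)"
      using \<phi>_orb[OF assms(1,3) cst_in[OF True]] a_in[OF assms(3)] by (simp add: cst_def)
    moreover have "orb q k = \<phi> (cst k) (orb q j)"
      using \<phi>_orb[OF assms(2,4) cst_in[OF True]] a_in[OF assms(4)] by (simp add: cst_def)
    ultimately show ?thesis using assms(5) by simp
  next
    case False
    then show ?thesis unfolding orb_def restrict_apply by (simp only: if_False)
  qed
qed

text \<open>If \<open>a i\<close> and \<open>a j\<close> differed, some \<open>g\<close> would send
  them to \<open>x\<close> and \<open>y\<close>, and \<open>\<phi> g\<close> would send one point to
  two different ones.\<close>

lemma orb_kernel:
  assumes p: "p \<in> {1..m}" and ij: "i \<in> {1..n}" "j \<in> {1..n}" and eq: "orb p i = orb p j"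
    and xy: "x \<in> {1..n}" "y \<in> {1..n}" "orb p x \<noteq> orb p y"
  shows "a i = a j"
proof (rule ccontr)
  assume ne: "a i \<noteq> a j"
  define g where "g = (\<lambda>z\<in>{1..n}. if z = a i then x else y)"
  have g: "g \<in> full_trans n" unfolding g_def using xy by (intro restrict_full_trans) auto
  have "g (a i) = x" "g (a j) = y" using ne ij a_in by (auto simp: g_def)
  then show False using \<phi>_orb[OF p ij(1) g] \<phi>_orb[OF p ij(2) g] eq xy by simp
qed

lemma orb_separates:
  assumes "i \<in> {1..n}" "j \<in> {1..n}" "i \<noteq> j"
  shows "\<exists>p\<in>{1..m}. orb p i \<noteq> orb p j"
proof (rule ccontr)
  assume "\<not> ?thesis"
  then have "cst i = cst j"
    using assms by (intro \<phi>_eqD cst_in) (auto simp: orb_def)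
  from fun_cong[OF this, of 1] show False using assms by (simp add: cst_def)
qed

lemma card_imgs_cases:
  assumes "n \<le> trans_rank n a + 6"
  shows "n \<le> card imgs \<or> (n \<le> card imgs + 1 \<and> trans_rank n a < n)
    \<or> (n = 7 \<and> trans_rank n a = 1 \<and> 5 \<le> card imgs)"
proof -
  \<comment> \<open>Constant orbit maps are discarded because \<open>orb_kernel\<close> needs two
    distinct values; a map that separates two points is never constant.\<close>
  define P where "P = {\<pi> \<in> orb ` {1..m}. \<exists>x\<in>{1..n}. \<exists>y\<in>{1..n}. \<pi> x \<noteq> \<pi> y}"
  have finP: "finite P" by (simp add: P_def)
  have sep: "\<exists>\<pi>\<in>P. \<pi> x \<noteq> \<pi> y" if "x \<in> {1..n}" "y \<in> {1..n}" "x \<noteq> y" for x y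
    using orb_separates[OF that] that by (fastforce simp: P_def)
  have ker: "a x = a y" if "\<pi> \<in> P" "x \<in> {1..n}" "y \<in> {1..n}" "\<pi> x = \<pi> y" for \<pi> x y
    using that orb_kernel unfolding P_def by blast
  have "card (\<Union>\<pi>\<in>P. \<pi> ` {1..n}) = (\<Sum>\<pi>\<in>P. card (\<pi> ` {1..n}))"
    using finP orb_eqI unfolding P_def by (intro card_UN_disjoint) (simp, simp, blast)
  moreover have "(\<Union>\<pi>\<in>P. \<pi> ` {1..n}) \<subseteq> imgs"
    proof (intro UN_least image_subsetI)
    fix \<pi> i assume "\<pi> \<in> P" and i: "i \<in> {1..n}"
    then obtain p where "p \<in> {1..m}" "\<pi> = orb p" unfolding P_def by blast
    then show "\<pi> i \<in> imgs" using i imgsI[OF cst_in[OF i]] by (simp add: orb_def)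
  qed
  ultimately have C: "(\<Sum>\<pi>\<in>P. card (\<pi> ` {1..n})) \<le> card imgs"
    using card_mono[OF finite_imgs] by metis
  show ?thesis
  proof (cases "2 \<le> card P")
    case True
    show ?thesis
      using sum_card_images_ge[OF _ finP True sep ker _ C] n2 assms
      by (simp add: trans_rank_def)
  next
    case False
    \<comment> \<open>A single member must separate all points by itself, so it is injective and
      \<open>imgs\<close> has at least \<open>n\<close> points.\<close>
    have "P \<noteq> {}" using sep[of 1 2] n2 by auto
    then have "card P = 1" using False finP card_gt_0_iff[of P] by linarith
    then obtain \<pi> where \<pi>: "P = {\<pi>}" by (auto simp: card_1_singleton_iff)
    have "inj_on \<pi> {1..n}" by (rule inj_onI) (use sep \<pi> in blast)
    then have "card (\<pi> ` {1..n}) = n" by (simp add: card_image)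
    then show ?thesis using C \<pi> by simp
  qed
qed

lemma degree_ge:
  assumes "n \<le> trans_rank n a + 6"
  shows "2 * n - trans_rank n a \<le> m"
proof -
  have "card (a ` {1..n}) \<noteq> 0" using n2 by simp
  \<comment> \<open>Positive rank makes the defect less than \<open>n\<close>, as
    \<open>degree_arith\<close> requires.\<close>
  then have r: "1 \<le> trans_rank n a" unfolding trans_rank_def by linarith
  have "n + (n - trans_rank n a) \<le> card imgs + (m - card imgs)"
    using card_imgs_cases[OF assms] r n2
    by (intro degree_arith power_defect_le) auto
  moreover have "card imgs \<le> m" using card_mono[OF _ imgs_sub] by simp
  ultimately show ?thesis using trans_rank_le[of n a] by linarith
qed

end

theorem theorem5p15:
  fixes n r :: nat and a :: "nat \<Rightarrow> nat"
  assumes "n \<ge> 1"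
    and "a \<in> full_trans n"
    and "r = trans_rank n a"
    and "int r \<ge> int n - 6"
  shows "min_trans_degree (full_trans n) (variant_mult n a) = 2 * n - r"
  unfolding min_trans_degree_def
proof (rule Least_equality)
  show "1 \<le> 2 * n - r \<and> embeds_in_trans (full_trans n) (variant_mult n a) (2 * n - r)"
    using variant_embeds[OF assms(2)] assms(1,3) trans_rank_le[of n a] by simp
next
  fix m assume m: "1 \<le> m \<and> embeds_in_trans (full_trans n) (variant_mult n a) m"
  then obtain \<phi> where
    emb: "semigroup_embedding \<phi> (full_trans n) (variant_mult n a) (full_trans m) (trans_mult m)"
    by (auto simp: embeds_in_trans_def)
  show "2 * n - r \<le> m"
  proof (cases "2 \<le> n")
    case True
    then interpret variant_embedding n m a \<phi> using assms(2) emb by unfold_locales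
    show ?thesis using degree_ge assms(3,4) by simp
  next
    case False
    \<comment> \<open>Here the rank is 1, so the claim reduces to \<open>1 \<le> m\<close>.\<close>
    then have "n = 1" using assms(1) by simp
    then show ?thesis using m assms(3) by (simp add: trans_rank_def)
  qed
qed

end
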